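(* Let $X$ be a nonzero real uniformly convex and uniformly smooth Banach space, and let $R>0$. Let $A\subset X$ be a nonempty closed set which is proximally smooth with constant $R$ and is contained in a closed ball of radius $r<\frac{R}{\zeta_X}$. Then $A$ is contractible.
   Context: For a real normed space $X$, $B_R(c)$ denotes the closed ball with center $c$ and radius $R>0$, $o$ is the origin, $\operatorname{co} D$ is the convex hull of $D$, and $\rho(x,A)=\inf_{a\in A}\|x-a\|$. The deviation of $A$ from $B$ is $h^{+}(A,B)=\sup_{x\in A}\rho(x,B)$. The CHD-constant (convex hull deviation constant) of $X$ is $\zeta_X=\sup h^{+}(\operatorname{co} D, D)$, where the supremum is over all nonempty sets $D\subset B_1(o)$. A set $A\subset X$ is called proximally smooth with constant $R$ if the distance function $x\mapsto\rho(x,A)$ is continuously differentiable on the set $U(R,A)=\{x\in X: 0<\rho(x,A)<R\}$. *)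

theory Defs
  imports "HOL-Analysis.Analysis"
begin

text \<open>
  The properties of a space are predicates on the type of its points, passed as \<open>TYPE('a)\<close>.
  The distance \<open>\<rho>(x, A)\<close> is the library's \<open>infdist x A\<close>.
\<close>

definition uniformly_convex_space :: "'a::real_normed_vector itself \<Rightarrow> bool" where
  "uniformly_convex_space _ \<longleftrightarrow>
     (\<forall>\<epsilon>>0. \<exists>\<delta>>0. \<forall>x y :: 'a.
        norm x = 1 \<longrightarrow> norm y = 1 \<longrightarrow> \<epsilon> \<le> norm (x - y) \<longrightarrow> norm ((1 / 2) *\<^sub>R (x + y)) \<le> 1 - \<delta>)"

definition uniformly_smooth_space :: "'a::real_normed_vector itself \<Rightarrow> bool" where
  "uniformly_smooth_space _ \<longleftrightarrow>
     (\<forall>\<epsilon>>0. \<exists>\<delta>>0. \<forall>x y :: 'a.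
        norm x = 1 \<longrightarrow> norm y \<le> \<delta> \<longrightarrow> norm (x + y) + norm (x - y) \<le> 2 + \<epsilon> * norm y)"

text \<open>
  Suprema are taken in the reals.  For \<open>A\<close> nonempty and bounded and \<open>B\<close> nonempty the set of
  distances is nonempty and bounded, and for the sets \<open>D\<close> in the second definition all deviations
  lie between 0 and 2, so neither supremum is a junk value there (the second family is nonempty
  because \<open>D = {0}\<close> belongs to it).
\<close>

definition deviation :: "'a::metric_space set \<Rightarrow> 'a set \<Rightarrow> real" where
  "deviation A B = (SUP x\<in>A. infdist x B)"

definition chd_constant :: "'a::real_normed_vector itself \<Rightarrow> real" where
  "chd_constant _ = (SUP D\<in>{D :: 'a set. D \<noteq> {} \<and> D \<subseteq> cball 0 1}. deviation (convex hull D) D)"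

text \<open>
  Differentiability is in the sense of Frechet, and the derivative is continuous as a map into the
  dual space with its operator norm.
\<close>

definition proximally_smooth :: "real \<Rightarrow> 'a::real_normed_vector set \<Rightarrow> bool" where
  "proximally_smooth R A \<longleftrightarrow>
     (let U = {x. 0 < infdist x A \<and> infdist x A < R} in
      \<exists>f' :: 'a \<Rightarrow> 'a \<Rightarrow>\<^sub>L real.
        (\<forall>x\<in>U. ((\<lambda>x. infdist x A) has_derivative blinfun_apply (f' x)) (at x)) \<and>
        continuous_on U f')"

end

theory Submission
  imports Defs
begin

text \<open>
  The contraction of \<open>A\<close> is a straight-line homotopy in \<open>convex hull A\<close>, pushed back onto \<open>A\<close> by
  the metric projection.  This works as soon as the projection is a continuous retraction of
  \<open>convex hull A\<close> onto \<open>A\<close>.  Two independent facts provide that.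

  First, the hull stays inside the tube \<open>{x. infdist x A < R}\<close>: by translation and scaling, the
  CHD-constant \<open>\<zeta>\<close> bounds \<open>infdist x A\<close> by \<open>\<zeta> * r < R\<close> for \<open>x\<close> in the hull
  (\<open>infdist_convex_hull_le\<close>).

  Second, the projection is continuous on the tube.  Let \<open>d\<close> be the distance function of \<open>A\<close>,
  Frechet differentiable with derivative \<open>f\<close> at a point \<open>x\<close> off \<open>A\<close>.  As \<open>d\<close> is 1-Lipschitz,
  \<open>f\<close> has norm at most 1.  Moving from \<open>x\<close> towards an almost nearest point \<open>a\<close> of \<open>A\<close> decreases
  \<open>d\<close> at almost unit speed, so \<open>f\<close> almost attains the value 1 at the unit vector pointing from
  \<open>a\<close> to \<open>x\<close> (\<open>derivative_infdist_almost_norming\<close>).  In a uniformly convex space, unit vectors at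
  which a fixed functional of norm at most 1 is close to 1 are close to each other
  (\<open>uniformly_convex_almost_norming_close\<close>).  Hence any two almost nearest points are close to each
  other (\<open>well_posed_projection_if_differentiable\<close>).  In a complete space this clustering gives at
  once the existence of a nearest point and its continuous dependence on \<open>x\<close>
  (\<open>continuous_metric_projection\<close>).
\<close>

section \<open>Well-posedness and continuity of the metric projection\<close>

text \<open>
  Well-posedness in the sense of Tikhonov for the problem of minimizing the distance from \<open>x\<close> over
  \<open>A\<close>: the sets of almost minimizers shrink to diameter zero.
\<close>

definition well_posed_projection :: "'a::metric_space set \<Rightarrow> 'a \<Rightarrow> bool" where
  "well_posed_projection A x \<longleftrightarrow>
     (\<forall>\<epsilon>>0. \<exists>\<eta>>0. \<forall>a\<in>A. \<forall>b\<in>A. dist x a < infdist x A + \<eta> \<longrightarrow> dist x b < infdist x A + \<eta> \<longrightarrow>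
        dist a b < \<epsilon>)"

lemma well_posed_projection_self:
  assumes "x \<in> A"
  shows "well_posed_projection A x"
  unfolding well_posed_projection_def
proof (intro allI impI)
  fix \<epsilon> :: real
  assume "\<epsilon> > 0"
  moreover have "dist a b < \<epsilon>" if "dist x a < \<epsilon> / 2" "dist x b < \<epsilon> / 2" for a b
    using that dist_triangle2[of a b x] by (simp add: dist_commute)
  ultimately show "\<exists>\<eta>>0. \<forall>a\<in>A. \<forall>b\<in>A. dist x a < infdist x A + \<eta> \<longrightarrow> dist x b < infdist x A + \<eta> \<longrightarrow>
      dist a b < \<epsilon>"
    using assms by (intro exI[of _ "\<epsilon> / 2"]) simp
qed

lemma ex_almost_nearest:
  assumes "A \<noteq> {}" and "0 < \<eta>"
  shows "\<exists>a\<in>A. dist x a < infdist x A + \<eta>"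
  using assms cInf_lessD[of "dist x ` A" "infdist x A + \<eta>"] by (auto simp: infdist_notempty)

text \<open>
  A minimizing sequence is Cauchy because its tail consists of almost minimizers.
\<close>

lemma well_posed_projection_imp_nearest:
  fixes A :: "'a::complete_space set"
  assumes "closed A" and "A \<noteq> {}" and "well_posed_projection A x"
  shows "\<exists>p\<in>A. dist x p = infdist x A"
proof -
  have "\<forall>n. \<exists>a\<in>A. dist x a < infdist x A + inverse (real (Suc n))"
    using assms(2) ex_almost_nearest by (metis inverse_positive_iff_positive of_nat_0_less_iff zero_less_Suc)
  then obtain a where a: "\<And>n. a n \<in> A" "\<And>n. dist x (a n) < infdist x A + inverse (real (Suc n))"
    by metis
  have "Cauchy a"
    unfolding Cauchy_def
  proof (intro allI impI)
    fix \<epsilon> :: real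
    assume "\<epsilon> > 0"
    then obtain \<eta> where "\<eta> > 0" and \<eta>: "\<And>a b. a \<in> A \<Longrightarrow> b \<in> A \<Longrightarrow> dist x a < infdist x A + \<eta> \<Longrightarrow>
        dist x b < infdist x A + \<eta> \<Longrightarrow> dist a b < \<epsilon>"
      using assms(3) unfolding well_posed_projection_def by meson
    obtain N where N: "inverse (real (Suc N)) < \<eta>"
      using reals_Archimedean \<open>\<eta> > 0\<close> by blast
    have "dist x (a n) < infdist x A + \<eta>" if "n \<ge> N" for n
    proof -
      have "inverse (real (Suc n)) \<le> inverse (real (Suc N))"
        using that by (simp add: le_imp_inverse_le)
      then show ?thesis
        using a(2)[of n] N by linarith
    qed
    then show "\<exists>M. \<forall>m\<ge>M. \<forall>n\<ge>M. dist (a m) (a n) < \<epsilon>"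
      using \<eta> a(1) by blast
  qed
  then obtain p where p: "a \<longlonglongrightarrow> p"
    using Cauchy_convergent_iff convergent_def by blast
  then have "p \<in> A"
    using assms(1) a(1) closed_sequentially by blast
  have "(\<lambda>n. infdist x A + inverse (real (Suc n))) \<longlonglongrightarrow> infdist x A + 0"
    by (intro tendsto_intros LIMSEQ_inverse_real_of_nat)
  moreover have "(\<lambda>n. dist x (a n)) \<longlonglongrightarrow> dist x p"
    by (intro tendsto_intros p)
  ultimately have "dist x p \<le> infdist x A + 0"
    using a(2) by (intro LIMSEQ_le) (auto intro: less_imp_le)
  then show ?thesis
    using \<open>p \<in> A\<close> infdist_le[of p A x] by (intro bexI[of _ p]) auto
qed

text \<open>
  The projection is continuous because a nearest point of a point \<open>y\<close> close to \<open>x\<close> is an almost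
  nearest point of \<open>x\<close>.
\<close>

lemma continuous_metric_projection:
  fixes A W :: "'a::complete_space set"
  assumes "closed A" and "A \<noteq> {}" and "\<And>x. x \<in> W \<Longrightarrow> well_posed_projection A x"
  obtains p where "continuous_on W p" and "\<And>x. x \<in> W \<Longrightarrow> p x \<in> A \<and> dist x (p x) = infdist x A"
proof -
  obtain p where p: "\<And>x. x \<in> W \<Longrightarrow> p x \<in> A \<and> dist x (p x) = infdist x A"
    using well_posed_projection_imp_nearest[OF assms(1,2)] assms(3) by metis
  have "continuous_on W p"
    unfolding continuous_on_iff
  proof (intro ballI allI impI)
    fix x and \<epsilon> :: real
    assume "x \<in> W" "\<epsilon> > 0"
    then obtain \<eta> where "\<eta> > 0" and \<eta>: "\<And>a b. a \<in> A \<Longrightarrow> b \<in> A \<Longrightarrow> dist x a < infdist x A + \<eta> \<Longrightarrow>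
        dist x b < infdist x A + \<eta> \<Longrightarrow> dist a b < \<epsilon>"
      using assms(3) unfolding well_posed_projection_def by meson
    have "dist (p y) (p x) < \<epsilon>" if "y \<in> W" "dist y x < \<eta> / 2" for y
    proof (rule \<eta>)
      have "dist x (p y) \<le> dist y x + infdist y A"
        using p[OF \<open>y \<in> W\<close>] dist_triangle[of x "p y" y] by (simp add: dist_commute)
      also have "\<dots> \<le> infdist x A + 2 * dist y x"
        using infdist_triangle[of y A x] by simp
      finally show "dist x (p y) < infdist x A + \<eta>"
        using that by simp
    qed (use p \<open>x \<in> W\<close> \<open>y \<in> W\<close> \<open>\<eta> > 0\<close> in auto)
    then show "\<exists>d>0. \<forall>y\<in>W. dist y x < d \<longrightarrow> dist (p y) (p x) < \<epsilon>"
      using \<open>\<eta> > 0\<close> by (meson half_gt_zero)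
  qed
  then show thesis
    using that p by blast
qed

section \<open>Derivative of the distance function\<close>

lemma derivative_infdist_le_norm:
  assumes "((\<lambda>x. infdist x A) has_derivative f) (at x)"
  shows "f z \<le> norm z"
proof (cases "z = 0")
  case True
  then show ?thesis
    using assms by (simp add: has_derivative_bounded_linear linear_simps)
next
  case False
  interpret bounded_linear f
    using assms by (rule has_derivative_bounded_linear)
  have "f z / norm z \<le> 1"
  proof (rule field_le_epsilon)
    fix e :: real
    assume "e > 0"
    then obtain \<tau> where "\<tau> > 0" and \<tau>: "\<And>y. norm (y - x) < \<tau> \<Longrightarrow>
        \<bar>infdist y A - infdist x A - f (y - x)\<bar> \<le> e * norm (y - x)"
      using assms unfolding has_derivative_at_alt real_norm_def by meson
    define t where "t = \<tau> / (2 * norm z)"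
    have "t > 0" "norm (t *\<^sub>R z) < \<tau>"
      using \<open>\<tau> > 0\<close> False by (auto simp: t_def)
    then have "\<bar>infdist (x + t *\<^sub>R z) A - infdist x A - t * f z\<bar> \<le> e * (t * norm z)"
      using \<tau>[of "x + t *\<^sub>R z"] by (simp add: scaleR)
    moreover have "infdist (x + t *\<^sub>R z) A - infdist x A \<le> t * norm z"
      using infdist_triangle[of "x + t *\<^sub>R z" A x] \<open>t > 0\<close> by (simp add: dist_norm)
    ultimately have "t * f z \<le> t * (norm z * (1 + e))"
      by (simp add: algebra_simps)
    then have "f z \<le> norm z * (1 + e)"
      using \<open>t > 0\<close> by (rule mult_left_le_imp_le)
    then show "f z / norm z \<le> 1 + e"
      using False by (simp add: field_simps)
  qed
  then show ?thesis
    using False by (simp add: field_simps)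
qed

text \<open>
  For \<open>0 < t \<le> 1\<close> the point \<open>x + t *\<^sub>R (a - x)\<close> has distance \<open>(1 - t) * dist x a\<close>
  from \<open>a\<close>, so \<open>infdist\<close> drops by almost \<open>t * dist x a\<close> on the way there.  The step \<open>t\<close> is fixed
  first, by the derivative at \<open>x\<close>; the excess \<open>\<eta>\<close> of \<open>dist x a\<close> over the infimum must then be
  small compared with \<open>t\<close>.
\<close>

lemma derivative_infdist_almost_norming:
  assumes "((\<lambda>x. infdist x A) has_derivative f) (at x)" and "0 < infdist x A" and "0 < \<delta>"
  obtains \<eta> where "0 < \<eta>"
    and "\<And>a. a \<in> A \<Longrightarrow> dist x a < infdist x A + \<eta> \<Longrightarrow> 1 - \<delta> < f (sgn (x - a))"
proof -
  interpret bounded_linear f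
    using assms(1) by (rule has_derivative_bounded_linear)
  define d where "d = infdist x A"
  have "d > 0"
    using assms(2) d_def by simp
  obtain \<tau> where "\<tau> > 0" and \<tau>: "\<And>y. norm (y - x) < \<tau> \<Longrightarrow>
      \<bar>infdist y A - d - f (y - x)\<bar> \<le> \<delta> / 2 * norm (y - x)"
    using assms unfolding has_derivative_at_alt real_norm_def d_def by (meson half_gt_zero)
  define t where "t = min 1 (\<tau> / (2 * (d + 1)))"
  have "0 < t" "t \<le> 1" "t \<le> \<tau> / (2 * (d + 1))"
    using \<open>\<tau> > 0\<close> \<open>d > 0\<close> by (auto simp: t_def)
  then have "t * (d + 1) < \<tau>"
    using \<open>\<tau> > 0\<close> \<open>d > 0\<close> by (simp add: field_simps)
  \<comment> \<open>One half of \<open>\<delta>\<close> absorbs the linearization error, the other half the excess over the infimum.\<close>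
  define \<eta> where "\<eta> = min 1 (\<delta> / 2 * t * d)"
  have "\<eta> > 0" "\<eta> \<le> 1" "\<eta> \<le> \<delta> / 2 * t * d"
    using \<open>0 < t\<close> \<open>d > 0\<close> \<open>0 < \<delta>\<close> by (auto simp: \<eta>_def)
  have "1 - \<delta> < f (sgn (x - a))" if "a \<in> A" "dist x a < d + \<eta>" for a
  proof -
    define s where "s = norm (x - a)"
    have "d \<le> s" "s < d + \<eta>"
      using that infdist_le[of a A x] by (auto simp: s_def d_def dist_norm)
    define y where "y = x + t *\<^sub>R (a - x)"
    have "y - x = - (t *\<^sub>R (x - a))"
      by (simp add: y_def algebra_simps)
    then have fy: "f (y - x) = - (t * f (x - a))" and ny: "norm (y - x) = t * s"
      using \<open>0 < t\<close> by (simp_all add: linear_neg[OF linear_axioms] scaleR s_def)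
    have "t * s \<le> t * (d + 1)"
      using \<open>s < d + \<eta>\<close> \<open>\<eta> \<le> 1\<close> \<open>0 < t\<close> by (intro mult_left_mono) auto
    then have "norm (y - x) < \<tau>"
      using ny \<open>t * (d + 1) < \<tau>\<close> by simp
    then have "\<bar>infdist y A - d - f (y - x)\<bar> \<le> \<delta> / 2 * norm (y - x)"
      by (rule \<tau>)
    then have "d - t * f (x - a) - infdist y A \<le> \<delta> / 2 * (t * s)"
      unfolding fy ny by linarith
    moreover have "infdist y A \<le> (1 - t) * s"
    proof -
      have "y - a = (1 - t) *\<^sub>R (x - a)"
        by (simp add: y_def algebra_simps)
      then have "dist y a = (1 - t) * s"
        using \<open>t \<le> 1\<close> by (simp add: dist_norm s_def)
      then show ?thesis
        using infdist_le[OF \<open>a \<in> A\<close>, of y] by simp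
    qed
    ultimately have "t * s - t * f (x - a) \<le> \<delta> / 2 * (t * s) + (s - d)"
      by (simp add: algebra_simps)
    also have "\<dots> < \<delta> / 2 * (t * s) + \<delta> / 2 * t * d"
      using \<open>s < d + \<eta>\<close> \<open>\<eta> \<le> \<delta> / 2 * t * d\<close> by simp
    also have "\<dots> \<le> \<delta> / 2 * (t * s) + \<delta> / 2 * t * s"
      using \<open>d \<le> s\<close> \<open>0 < t\<close> \<open>0 < \<delta>\<close> by (intro add_left_mono mult_left_mono) auto
    finally have "t * (s - f (x - a)) < t * (\<delta> * s)"
      by (simp add: algebra_simps)
    then have "s - f (x - a) < \<delta> * s"
      using \<open>0 < t\<close> by simp
    then have "1 - \<delta> < f (x - a) / s"
      using less_le_trans[OF \<open>d > 0\<close> \<open>d \<le> s\<close>] by (simp add: field_simps)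
    also have "\<dots> = f (sgn (x - a))"
      by (simp add: sgn_div_norm scaleR s_def divide_inverse)
    finally show ?thesis .
  qed
  then show thesis
    using that \<open>\<eta> > 0\<close> by (simp add: d_def)
qed

section \<open>Differentiability and uniform convexity\<close>

text \<open>
  If \<open>f\<close> exceeds \<open>1 - \<delta>\<close> at two unit vectors, then also at their midpoint, whose norm is then
  more than \<open>1 - \<delta>\<close>; uniform convexity allows this only for vectors close to each other.
\<close>

lemma uniformly_convex_almost_norming_close:
  assumes "uniformly_convex_space TYPE('a::real_normed_vector)" and "0 < \<epsilon>"
  obtains \<delta> where "0 < \<delta>"
    and "\<And>f u v. linear f \<Longrightarrow> (\<And>z::'a. f z \<le> norm z) \<Longrightarrow> norm u = 1 \<Longrightarrow> norm v = 1 \<Longrightarrow>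
           1 - \<delta> < f u \<Longrightarrow> 1 - \<delta> < f v \<Longrightarrow> norm (u - v) < \<epsilon>"
proof -
  obtain \<delta> where "\<delta> > 0" and \<delta>: "\<And>u v :: 'a. norm u = 1 \<Longrightarrow> norm v = 1 \<Longrightarrow> \<epsilon> \<le> norm (u - v) \<Longrightarrow>
      norm ((1 / 2) *\<^sub>R (u + v)) \<le> 1 - \<delta>"
    using assms unfolding uniformly_convex_space_def by meson
  have "norm (u - v) < \<epsilon>"
    if "linear f" "\<And>z::'a. f z \<le> norm z" "norm u = 1" "norm v = 1" "1 - \<delta> < f u" "1 - \<delta> < f v"
    for f :: "'a \<Rightarrow> real" and u v
  proof (rule ccontr)
    assume "\<not> norm (u - v) < \<epsilon>"
    then have "f ((1 / 2) *\<^sub>R (u + v)) \<le> 1 - \<delta>"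
      using \<delta>[of u v] that(2)[of "(1 / 2) *\<^sub>R (u + v)"] that(3,4) by simp
    moreover have "f ((1 / 2) *\<^sub>R (u + v)) = (f u + f v) / 2"
      using \<open>linear f\<close> by (simp add: linear_add linear_scale)
    ultimately show False
      using that(5,6) by simp
  qed
  then show thesis
    using that \<open>\<delta> > 0\<close> by blast
qed

text \<open>
  The unit vectors from almost nearest points \<open>a\<close>, \<open>b\<close> to \<open>x\<close> are close because the value of the
  derivative is almost 1 at both; the lengths \<open>dist x a\<close>, \<open>dist x b\<close> are close because both are almost
  equal to the infimum.  So \<open>a\<close> and \<open>b\<close> are close.
\<close>

lemma well_posed_projection_if_differentiable:
  fixes A :: "'a::real_normed_vector set"
  assumes "uniformly_convex_space TYPE('a)"
    and "((\<lambda>x. infdist x A) has_derivative f) (at x)" and "0 < infdist x A"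
  shows "well_posed_projection A x"
  unfolding well_posed_projection_def
proof (intro allI impI)
  fix \<epsilon> :: real
  assume "\<epsilon> > 0"
  define d where "d = infdist x A"
  have "d > 0"
    using assms(3) d_def by simp
  have "linear f"
    using assms(2) has_derivative_linear by blast
  obtain \<delta> where "\<delta> > 0" and \<delta>: "\<And>u v. norm u = 1 \<Longrightarrow> norm v = 1 \<Longrightarrow>
      1 - \<delta> < f u \<Longrightarrow> 1 - \<delta> < f v \<Longrightarrow> norm (u - v) < \<epsilon> / (2 * (d + 1))"
    using uniformly_convex_almost_norming_close[OF assms(1), of "\<epsilon> / (2 * (d + 1))"]
      derivative_infdist_le_norm[OF assms(2)] \<open>linear f\<close> \<open>\<epsilon> > 0\<close> \<open>d > 0\<close>
    by (smt (verit) divide_pos_pos)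
  obtain \<eta>\<^sub>0 where "\<eta>\<^sub>0 > 0" and \<eta>\<^sub>0: "\<And>a. a \<in> A \<Longrightarrow> dist x a < d + \<eta>\<^sub>0 \<Longrightarrow> 1 - \<delta> < f (sgn (x - a))"
    using derivative_infdist_almost_norming[OF assms(2,3) \<open>\<delta> > 0\<close>] unfolding d_def by metis
  define \<eta> where "\<eta> = min (min 1 (\<epsilon> / 2)) \<eta>\<^sub>0"
  have \<eta>: "\<eta> > 0" "\<eta> \<le> 1" "\<eta> \<le> \<epsilon> / 2" "\<eta> \<le> \<eta>\<^sub>0"
    using \<open>\<epsilon> > 0\<close> \<open>\<eta>\<^sub>0 > 0\<close> by (auto simp: \<eta>_def)
  have "dist a b < \<epsilon>" if ab: "a \<in> A" "b \<in> A" "dist x a < d + \<eta>" "dist x b < d + \<eta>" for a b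
  proof -
    define u v where "u = sgn (x - a)" and "v = sgn (x - b)"
    have d_le: "d \<le> dist x a" "d \<le> dist x b"
      using ab by (auto simp: d_def infdist_le)
    then have "norm u = 1" "norm v = 1"
      using \<open>d > 0\<close> by (auto simp: u_def v_def norm_sgn)
    then have uv: "norm (u - v) < \<epsilon> / (2 * (d + 1))"
      using \<delta> \<eta>\<^sub>0 ab \<eta>(4) by (auto simp: u_def v_def)
    have "dist x a *\<^sub>R u = x - a" "dist x b *\<^sub>R v = x - b"
      by (cases "x = a"; cases "x = b"; simp add: u_def v_def sgn_div_norm dist_norm)+
    then have "b - a = (dist x a - dist x b) *\<^sub>R u + dist x b *\<^sub>R (u - v)"
      by (simp add: scaleR_diff_left scaleR_diff_right)
    then have "dist a b \<le> \<bar>dist x a - dist x b\<bar> + dist x b * norm (u - v)"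
      using norm_triangle_ineq[of "(dist x a - dist x b) *\<^sub>R u" "dist x b *\<^sub>R (u - v)"] \<open>norm u = 1\<close>
      by (simp add: dist_norm norm_minus_commute[of a b])
    also have "\<dots> < \<eta> + (d + 1) * (\<epsilon> / (2 * (d + 1)))"
    proof (intro add_less_le_mono mult_mono)
      show "\<bar>dist x a - dist x b\<bar> < \<eta>"
        using ab d_le by auto
    qed (use uv ab \<eta> \<open>d > 0\<close> in auto)
    also have "(d + 1) * (\<epsilon> / (2 * (d + 1))) = \<epsilon> / 2"
      using \<open>d > 0\<close> by (simp add: field_simps)
    also have "\<eta> + \<epsilon> / 2 \<le> \<epsilon>"
      using \<eta>(3) by simp
    finally show ?thesis .
  qed
  then show "\<exists>\<eta>>0. \<forall>a\<in>A. \<forall>b\<in>A. dist x a < infdist x A + \<eta> \<longrightarrow> dist x b < infdist x A + \<eta> \<longrightarrow>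
      dist a b < \<epsilon>"
    using \<eta>(1) unfolding d_def by blast
qed

section \<open>Distance of a set from its convex hull\<close>

text \<open>
  The bound 2, the diameter of the unit ball, makes both suprema in the CHD-constant suprema of
  bounded sets of reals, so that they dominate their members.
\<close>

lemma infdist_convex_hull_le_chd_constant:
  fixes D :: "'a::real_normed_vector set"
  assumes "D \<subseteq> cball 0 1" and "x \<in> convex hull D"
  shows "infdist x D \<le> chd_constant TYPE('a)"
proof -
  have bound: "infdist y E \<le> 2" if E: "E \<noteq> {}" "E \<subseteq> cball 0 1" "y \<in> convex hull E" for E and y :: 'a
  proof -
    obtain e where "e \<in> E"
      using E(1) by blast
    have "y \<in> cball 0 1"
      using E hull_minimal[of E "cball 0 1" convex] by auto
    then have "dist y e \<le> 2"
      using \<open>e \<in> E\<close> E(2) dist_triangle[of y e 0] by (force simp: dist_commute)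
    then show ?thesis
      using infdist_le2 \<open>e \<in> E\<close> by blast
  qed
  have "D \<noteq> {}"
    using assms(2) by auto
  have "infdist x D \<le> deviation (convex hull D) D"
    unfolding deviation_def using assms(2) bound[OF \<open>D \<noteq> {}\<close> assms(1)]
    by (intro cSUP_upper bdd_aboveI2) auto
  also have "\<dots> \<le> chd_constant TYPE('a)"
    unfolding chd_constant_def
  proof (rule cSUP_upper)
    show "bdd_above ((\<lambda>D::'a set. deviation (convex hull D) D) ` {D. D \<noteq> {} \<and> D \<subseteq> cball 0 1})"
    proof (rule bdd_aboveI2)
      fix E :: "'a set"
      assume "E \<in> {D. D \<noteq> {} \<and> D \<subseteq> cball 0 1}"
      then show "deviation (convex hull E) E \<le> 2"
        unfolding deviation_def using bound by (intro cSUP_least) auto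
    qed
  qed (use \<open>D \<noteq> {}\<close> assms(1) in auto)
  finally show ?thesis .
qed

lemma infdist_convex_hull_le:
  fixes A :: "'a::real_normed_vector set"
  assumes "0 < r" and "A \<subseteq> cball c r" and "x \<in> convex hull A"
  shows "infdist x A \<le> chd_constant TYPE('a) * r"
proof -
  define D where "D = (\<lambda>y. (1 / r) *\<^sub>R (y - c)) ` A"
  define z where "z = (1 / r) *\<^sub>R (x - c)"
  have scale: "(1 / r) *\<^sub>R (y - c) = - ((1 / r) *\<^sub>R c) + (1 / r) *\<^sub>R y" for y
    by (simp add: algebra_simps)
  have "z \<in> convex hull D"
    unfolding D_def z_def scale convex_hull_affinity using assms(3) by blast
  moreover have "D \<subseteq> cball 0 1"
    using assms(1,2) by (auto simp: D_def dist_norm norm_minus_commute)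
  ultimately have z: "infdist z D \<le> chd_constant TYPE('a)"
    by (rule infdist_convex_hull_le_chd_constant[rotated])
  have "A \<noteq> {}"
    using assms(3) by auto
  have "infdist x A / r \<le> dist z y" if y: "y \<in> D" for y
  proof -
    obtain a where "a \<in> A" "y = (1 / r) *\<^sub>R (a - c)"
      using y D_def by blast
    then have "z - y = (1 / r) *\<^sub>R (x - a)"
      by (simp add: z_def algebra_simps)
    then have "dist z y = dist x a / r"
      using assms(1) by (simp add: dist_norm)
    then show ?thesis
      using infdist_le[OF \<open>a \<in> A\<close>, of x] assms(1) by (simp add: divide_right_mono)
  qed
  then have "infdist x A / r \<le> infdist z D"
    using \<open>A \<noteq> {}\<close> by (auto simp: infdist_notempty D_def intro!: cINF_greatest)
  then have "infdist x A / r \<le> chd_constant TYPE('a)"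
    using z by (rule order_trans)
  then show ?thesis
    using assms(1) by (simp add: pos_divide_le_eq)
qed

section \<open>Contractibility\<close>

theorem theorem6:
  fixes A :: "'a::banach set" and c :: 'a and R r :: real
  assumes "\<exists>x::'a. x \<noteq> 0"
    and "uniformly_convex_space TYPE('a)"
    and "uniformly_smooth_space TYPE('a)"
    and "0 < R"
    and "A \<noteq> {}"
    and "closed A"
    and "proximally_smooth R A"
    and "0 < r"
    and "r < R / chd_constant TYPE('a)"
    and "A \<subseteq> cball c r"
  shows "contractible A"
proof -
  \<comment> \<open>A nonpositive constant would make the quotient nonpositive, by \<open>R / 0 = 0\<close> in the extreme case.\<close>
  have "chd_constant TYPE('a) > 0"
    using assms(4,8,9) by (smt (verit) divide_nonneg_nonpos)
  then have "chd_constant TYPE('a) * r < R"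
    using assms(9) by (simp add: field_simps)
  then have hull_near: "infdist x A < R" if "x \<in> convex hull A" for x
    using infdist_convex_hull_le[OF assms(8,10) that] by simp
  have "well_posed_projection A x" if x: "x \<in> convex hull A" for x
  proof (cases "x \<in> A")
    case True
    then show ?thesis
      by (rule well_posed_projection_self)
  next
    case False
    then have "0 < infdist x A"
      using assms(5,6) infdist_pos_not_in_closed by blast
    moreover obtain f where "((\<lambda>x. infdist x A) has_derivative f) (at x)"
      using assms(7) hull_near[OF x] \<open>0 < infdist x A\<close>
      unfolding proximally_smooth_def Let_def by blast
    ultimately show ?thesis
      using well_posed_projection_if_differentiable assms(2) by blast
  qed
  then obtain p where "continuous_on (convex hull A) p"
    and p: "\<And>x. x \<in> convex hull A \<Longrightarrow> p x \<in> A \<and> dist x (p x) = infdist x A"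
    using continuous_metric_projection[OF assms(6,5)] by blast
  moreover have "p x = x" if "x \<in> A" for x
    using p[of x] that hull_inc[OF that] by fastforce
  ultimately have "A retract_of (convex hull A)"
    unfolding retract_of_def retraction_def by (auto simp: hull_subset)
  then show ?thesis
    using retract_of_contractible convex_imp_contractible convex_convex_hull by blast
qed

end
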